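(* Let $A$ be an alphabet (possibly infinite) and $\mathcal{L}\subset A^*$ a language with the specification property with constant $j$, together with a fixed choice of connecting words $\mathbf{u}_{\mathbf{a},\mathbf{b}}$ as described in the context. Let $\mu\in I$ be a shift-invariant probability measure. Let $W=((l_i,\epsilon_i,k_i,\nu_i))_{i=1}^{\infty}\in\mathscr{F}$ and let $(\omega_i)_{i=1}^{\infty}$ be a $(W,\mu)$-good sequence of words in $\mathcal{L}$. Put \[ \omega=\omega_1^{\odot l_1}\odot\omega_2^{\odot l_2}\odot\omega_3^{\odot l_3}\odot\cdots . \] Then for each $k\in R(W)$ the infinite word $\omega$ is $\mu$-normal of order $k$, i.e. $\omega\in\mathcal{N}_\mu^{(k)}$. Moreover, if $k_i\to\infty$, then $\omega$ is $\mu$-normal, i.e. $\omega\in\mathcal{N}_\mu=\bigcap_{k\ge1}\mathcal{N}_\mu^{(k)}$.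
   Context: Words and language. $A^+$ is the semigroup of nonempty finite words over $A$ under concatenation, $A^*=A^+\cup\{\varepsilon\}$, $|\omega|$ is the length of a word and $A^k$ the words of length $k$. A language $\mathcal{L}\subset A^*$ has the specification property if there is a positive integer $j$ such that for any $\mathbf{a},\mathbf{b}\in\mathcal{L}$ there is $\mathbf{u}\in\mathcal{L}$ with $|\mathbf{u}|\le j$ and $\mathbf{a}\mathbf{u}\mathbf{b}\in\mathcal{L}$; for every pair $\mathbf{a},\mathbf{b}$ one such word $\mathbf{u}_{\mathbf{a},\mathbf{b}}$ is fixed. Then $\mathbf{a}_1\odot\mathbf{a}_2\odot\cdots\odot\mathbf{a}_m:=\mathbf{a}_1\mathbf{u}_{\mathbf{a}_1,\mathbf{a}_2}\mathbf{a}_2\mathbf{u}_{\mathbf{a}_2,\mathbf{a}_3}\cdots\mathbf{u}_{\mathbf{a}_{m-1},\mathbf{a}_m}\mathbf{a}_m$, and $\mathbf{a}^{\odot n}$ is $\mathbf{a}\odot\cdots\odot\mathbf{a}$ ($n$ times); the infinite word $\omega$ is the limit of these iterated $\odot$-concatenations. $W^\infty$ is the set of infinite sequences $(a_i)_{i\ge1}$ with $a_i\cdots a_k\in\mathcal{L}$ for all $1\le i<k$; $T$ is the left shift; $\mathfrak{B}$ is the $\sigma$-algebra generated by cylinder sets $c(\mathbf{w})=\{a_1a_2\ldots: a_1\ldots a_n=\mathbf{w}\}$; $I$ is the set of $T$-invariant probability measures on $\mathfrak{B}$, and $\mu(\mathbf{w}):=\mu(c(\mathbf{w}))$. Counting and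 normality. For a word $\mathbf{b}$ of length $k$ and a (finite or infinite) word $\omega=a_1a_2\ldots$, $N_n(\mathbf{b},\omega)=\#\{0\le i<n: a_{i+1}\cdots a_{i+k}=\mathbf{b}\}$, and for finite $\omega$, $N(\mathbf{b},\omega)=N_{|\omega|}(\mathbf{b},\omega)$. A word $\mathbf{b}$ is $\mu$-admissible if $\mu(\mathbf{b})\neq0$; $\mathscr{D}_\mu$ is the set of $\mu$-admissible words and $\mathscr{D}_{\mu,k}$ those of length $k$. For $0<\epsilon<1$, $k\ge1$, $\nu\in I$, a finite word $\omega$ is $(\epsilon,k,\nu)$-normal if for all $t\le k$ and all $\mathbf{b}\in\mathscr{D}_{\nu,t}$: $\nu(\mathbf{b})|\omega|(1-\epsilon)\le N(\mathbf{b},\omega)\le\nu(\mathbf{b})|\omega|(1+\epsilon)$. An infinite word $\omega$ is $\mu$-normal of order $k$ ($\omega\in\mathcal{N}_\mu^{(k)}$) if $\lim_{n\to\infty}N_n(\mathbf{b},\omega)/n=\mu(\mathbf{b})$ for every $\mathbf{b}\in\mathscr{D}_{\mu,k}$. Convergence of measures. For $\nu_i,\mu\in I$, "$\nu_i\to\mu$" means weak convergence ($\nu_i(\mathbf{b})\to\mu(\mathbf{b})$ for every word $\mathbf{b}$) together with the standing assumptions that $\mathscr{D}_{\nu_i}\subset\mathscr{D}_\mu$ for all $i$ and that for each word $\mathbf{b}$ the sequence $(\nu_i(\mathbf{b}))_i$ is eventually non-increasing in $i$. The class $\mathscr{F}$ and goodness. $\mathscr{F}$ is the set of sequences $W=((l_i,\epsilon_i,k_i,\nu_i))_{i\ge1}$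 where $(l_i)$ and $(k_i)$ are non-decreasing sequences of non-negative integers, each $\nu_i\in I$, and $(\epsilon_i)$ strictly decreases to $0$. $R(W)=[1,\lim_{i\to\infty}k_i]\cap\mathbb{N}$. A sequence of words $(\omega_i)_{i\ge1}$ such that $(|\omega_i|)$ is non-decreasing and each $\omega_i$ is $(\epsilon_i,k_i,\nu_i)$-normal is called $(W,\mu)$-good if $\nu_i\to\mu$ and, as $i\to\infty$ (for $i\ge2$): (1) $\dfrac{1}{\epsilon_{i-1}-\epsilon_i}=o(|\omega_i|)$; (2) $\dfrac{l_{i-1}}{l_i}\cdot\dfrac{|\omega_{i-1}|}{|\omega_i|}=o(i^{-1})$; (3) $\dfrac{1}{l_i}\cdot\dfrac{|\omega_{i+1}|}{|\omega_i|}=o(1)$. *)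

theory Defs
  imports
    "HOL-Probability.Probability_Measure"
    "HOL-Library.Landau_Symbols"
    "HOL-Library.Omega_Words_Fun"
begin

text \<open>
  The alphabet is the type \<open>'a\<close>, of arbitrary cardinality. Finite words are lists; infinite words are
  the functions \<open>'a word = nat \<Rightarrow> 'a\<close> of \<^theory>\<open>HOL-Library.Omega_Words_Fun\<close>, so the letter
  \<open>a\<^sub>i\<close> of \<open>a\<^sub>1a\<^sub>2\<dots>\<close> is \<open>x (i - 1)\<close>. In contrast, sequences of words, of measures and of
  parameters are indexed from 1; their value at 0 is irrelevant.
\<close>

section \<open>Specification property and concatenation with connecting words\<close>

definition specification_property :: "'a list set \<Rightarrow> nat \<Rightarrow> bool" where
  "specification_property L j \<longleftrightarrow>
     0 < j \<and> (\<forall>a\<in>L. \<forall>b\<in>L. \<exists>u\<in>L. length u \<le> j \<and> a @ u @ b \<in> L)"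

definition connecting_words ::
  "'a list set \<Rightarrow> nat \<Rightarrow> ('a list \<Rightarrow> 'a list \<Rightarrow> 'a list) \<Rightarrow> bool" where
  "connecting_words L j u \<longleftrightarrow>
     (\<forall>a\<in>L. \<forall>b\<in>L. u a b \<in> L \<and> length (u a b) \<le> j \<and> a @ u a b @ b \<in> L)"

fun odot :: "('a list \<Rightarrow> 'a list \<Rightarrow> 'a list) \<Rightarrow> 'a list list \<Rightarrow> 'a list" where
  "odot u [] = []"
| "odot u [a] = a"
| "odot u (a # b # ws) = a @ u a b @ odot u (b # ws)"

text \<open>
  \<open>odot_blocks u l w n\<close> is \<open>w\<^sub>1\<^bsup>\<odot>l\<^sub>1\<^esup> \<odot> \<dots> \<odot> w\<^sub>n\<^bsup>\<odot>l\<^sub>n\<^esup>\<close>, read as the iterated concatenation of the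
  \<open>l\<^sub>1 + \<dots> + l\<^sub>n\<close> factors: connecting words depend on neighbouring factors only (the words
  \<open>w\<^sub>i\<^bsup>\<odot>l\<^sub>i\<^esup>\<close> themselves need not belong to the language), and a block with \<open>l\<^sub>i = 0\<close> is absent.
\<close>

definition odot_blocks ::
  "('a list \<Rightarrow> 'a list \<Rightarrow> 'a list) \<Rightarrow> (nat \<Rightarrow> nat) \<Rightarrow> (nat \<Rightarrow> 'a list) \<Rightarrow> nat \<Rightarrow> 'a list" where
  "odot_blocks u l w n = odot u (concat (map (\<lambda>i. replicate (l i) (w i)) [1..<Suc n]))"

text \<open>
  The limit of a sequence of words, each a prefix of the next, of unbounded length;
  lemma \<open>prefix_limit_word\<close> below shows that it extends all of them.
\<close>

definition limit_word :: "(nat \<Rightarrow> 'a list) \<Rightarrow> 'a word" where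
  "limit_word p n = p (LEAST m. n < length (p m)) ! n"

lemma prefix_limit_word:
  assumes chain: "\<And>m. \<exists>v. p (Suc m) = p m @ v"
    and unbounded: "\<And>n. \<exists>m. n < length (p m)"
  shows "prefix (length (p m)) (limit_word p) = p m"
proof -
  have ext: "\<exists>v. p m' = p m @ v" if "m \<le> m'" for m m'
    using that
  proof (induction m' rule: dec_induct)
    case (step m')
    then show ?case
      using chain[of m'] by auto
  qed simp
  have nth_eq: "p m' ! n = p m ! n" if "m \<le> m'" "n < length (p m)" for m m' n
    using ext[OF that(1)] that(2) by (auto simp: nth_append)
  have "limit_word p n = p m ! n" if "n < length (p m)" for n
    unfolding limit_word_def
    using that nth_eq[of "LEAST m. n < length (p m)" m n]
    by (metis (mono_tags, lifting) LeastI Least_le)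
  then show ?thesis
    by (intro nth_equalityI) (auto simp: subsequence_def)
qed

definition omega_word ::
  "('a list \<Rightarrow> 'a list \<Rightarrow> 'a list) \<Rightarrow> (nat \<Rightarrow> nat) \<Rightarrow> (nat \<Rightarrow> 'a list) \<Rightarrow> 'a word" where
  "omega_word u l w = limit_word (odot_blocks u l w)"

section \<open>Invariant measures\<close>

definition infinite_words :: "'a list set \<Rightarrow> 'a word set" where
  "infinite_words L = {x. \<forall>i k. i < k \<longrightarrow> subsequence x i (Suc k) \<in> L}"

definition cylinder :: "'a word set \<Rightarrow> 'a list \<Rightarrow> 'a word set" where
  "cylinder X w = {x \<in> X. prefix (length w) x = w}"

definition word_space :: "'a list set \<Rightarrow> 'a word measure" where
  "word_space L = sigma (infinite_words L) (range (cylinder (infinite_words L)))"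

abbreviation shift :: "'a word \<Rightarrow> 'a word" where
  "shift \<equiv> suffix 1"

definition invariant_measures :: "'a list set \<Rightarrow> 'a word measure set" where
  "invariant_measures L =
     {M. sets M = sets (word_space L) \<and> prob_space M \<and>
         shift \<in> measurable M M \<and> distr M M shift = M}"

definition word_prob :: "'a word measure \<Rightarrow> 'a list \<Rightarrow> real" where
  "word_prob M w = measure M (cylinder (space M) w)"

definition admissible :: "'a word measure \<Rightarrow> 'a list set" where
  "admissible M = {b. word_prob M b \<noteq> 0}"

section \<open>Counting and normality\<close>

definition count_fin :: "'a list \<Rightarrow> 'a list \<Rightarrow> nat" where
  "count_fin b w = card {i. i < length w \<and> take (length b) (drop i w) = b}"

definition count_inf :: "nat \<Rightarrow> 'a list \<Rightarrow> 'a word \<Rightarrow> nat" where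
  "count_inf n b x = card {i. i < n \<and> subsequence x i (i + length b) = b}"

definition normal_fin :: "real \<Rightarrow> nat \<Rightarrow> 'a word measure \<Rightarrow> 'a list \<Rightarrow> bool" where
  "normal_fin \<epsilon> k \<nu> w \<longleftrightarrow>
     (\<forall>t\<le>k. \<forall>b\<in>admissible \<nu>. length b = t \<longrightarrow>
        word_prob \<nu> b * real (length w) * (1 - \<epsilon>) \<le> real (count_fin b w) \<and>
        real (count_fin b w) \<le> word_prob \<nu> b * real (length w) * (1 + \<epsilon>))"

definition normal_order :: "'a word measure \<Rightarrow> nat \<Rightarrow> 'a word set" where
  "normal_order \<mu> k =
     {x. \<forall>b\<in>admissible \<mu>. length b = k \<longrightarrow>
           (\<lambda>n. real (count_inf n b x) / real n) \<longlonglongrightarrow> word_prob \<mu> b}"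

definition normal_words :: "'a word measure \<Rightarrow> 'a word set" where
  "normal_words \<mu> = (\<Inter>k\<in>{1..}. normal_order \<mu> k)"

section \<open>Parameter sequences and good sequences of words\<close>

definition measures_converge :: "(nat \<Rightarrow> 'a word measure) \<Rightarrow> 'a word measure \<Rightarrow> bool" where
  "measures_converge \<nu> \<mu> \<longleftrightarrow>
     (\<forall>b. (\<lambda>i. word_prob (\<nu> i) b) \<longlonglongrightarrow> word_prob \<mu> b) \<and>
     (\<forall>i\<ge>1. admissible (\<nu> i) \<subseteq> admissible \<mu>) \<and>
     (\<forall>b. \<forall>\<^sub>F i in sequentially. word_prob (\<nu> (Suc i)) b \<le> word_prob (\<nu> i) b)"

text \<open>The sequence \<open>W = ((l\<^sub>i, \<epsilon>\<^sub>i, k\<^sub>i, \<nu>\<^sub>i))\<^sub>i\<close> is given by its four components.\<close>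

definition class_F ::
  "'a list set \<Rightarrow> (nat \<Rightarrow> nat) \<Rightarrow> (nat \<Rightarrow> real) \<Rightarrow> (nat \<Rightarrow> nat) \<Rightarrow> (nat \<Rightarrow> 'a word measure) \<Rightarrow> bool"
  where
  "class_F L l \<epsilon> k \<nu> \<longleftrightarrow>
     mono_on {1..} l \<and> mono_on {1..} k \<and>
     (\<forall>i\<ge>1. \<nu> i \<in> invariant_measures L) \<and>
     (\<forall>i\<ge>1. \<epsilon> (Suc i) < \<epsilon> i) \<and> \<epsilon> \<longlonglongrightarrow> 0"

definition orders :: "(nat \<Rightarrow> nat) \<Rightarrow> nat set" where
  "orders k = {m. 1 \<le> m \<and> enat m \<le> lim (\<lambda>i. enat (k i))}"

text \<open>
  As \<open>x / 0 = 0\<close> in HOL, the asymptotic conditions alone would hold for \<open>l = 0\<close>; that the quotients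
  by \<open>l i\<close> are defined for large \<open>i\<close> is therefore required separately. For \<open>length (w i)\<close>
  this already follows from the first of the three conditions.
\<close>

definition good ::
  "(nat \<Rightarrow> nat) \<Rightarrow> (nat \<Rightarrow> real) \<Rightarrow> (nat \<Rightarrow> nat) \<Rightarrow> (nat \<Rightarrow> 'a word measure) \<Rightarrow>
   'a word measure \<Rightarrow> (nat \<Rightarrow> 'a list) \<Rightarrow> bool" where
  "good l \<epsilon> k \<nu> \<mu> w \<longleftrightarrow>
     mono_on {1..} (\<lambda>i. length (w i)) \<and>
     (\<forall>i\<ge>1. normal_fin (\<epsilon> i) (k i) (\<nu> i) (w i)) \<and>
     measures_converge \<nu> \<mu> \<and>
     (\<forall>\<^sub>F i in sequentially. l i \<noteq> 0) \<and>
     (\<lambda>i. 1 / (\<epsilon> (i - 1) - \<epsilon> i)) \<in> o(\<lambda>i. real (length (w i))) \<and>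
     (\<lambda>i. real (l (i - 1)) / real (l i) * (real (length (w (i - 1))) / real (length (w i))))
       \<in> o(\<lambda>i. 1 / real i) \<and>
     (\<lambda>i. 1 / real (l i) * (real (length (w (Suc i))) / real (length (w i)))) \<in> o(\<lambda>i. 1)"

end

theory Submission
  imports Defs
begin

text \<open>
  Read \<open>\<omega>\<close> as the concatenation of blocks \<open>c\<^sub>g v\<^sub>g\<close>, where \<open>v\<^sub>0, v\<^sub>1, \<dots>\<close> lists the words
  \<open>w\<^sub>i\<close> with multiplicity \<open>l\<^sub>i\<close> and \<open>c\<^sub>g\<close> is the connecting word in front of \<open>v\<^sub>g\<close>. Since
  \<open>|c\<^sub>g| \<le> j\<close>, the occurrences of \<open>b\<close> starting in the block number \<open>N(b, v\<^sub>g)\<close> up to an error of at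
  most \<open>j + |b|\<close>, so their frequency in the block tends to \<open>\<mu>(b)\<close> because \<open>|v\<^sub>g| \<rightarrow> \<infinity>\<close>. By
  the Stolz-Cesaro theorem the frequencies in the prefixes of \<open>\<omega>\<close> that end at a block boundary also
  tend to \<open>\<mu>(b)\<close>. Arbitrary prefixes are squeezed between consecutive boundaries: the third
  growth condition says that a single word \<open>w\<^sub>i\<close> is negligible against the whole preceding power
  \<open>w\<^sub>i\<^sub>-\<^sub>1\<^bsup>\<odot>l\<^sub>i\<^sub>-\<^sub>1\<^esup>\<close>.
\<close>

section \<open>Weighted averages and densities along block boundaries\<close>

text \<open>This is the Stolz-Cesaro theorem for partial sums. Beyond some index the error
  \<open>D n - p * W n\<close> is at most a small multiple of \<open>W n\<close>; the finitely many
  earlier errors add up to a constant, which the divergent total weight absorbs.\<close>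

lemma weighted_cesaro:
  fixes D W :: "nat \<Rightarrow> real"
  assumes lim: "(\<lambda>n. D n / W n) \<longlonglongrightarrow> p"
    and pos: "\<forall>\<^sub>F n in sequentially. 0 < W n"
    and at_top: "filterlim (\<lambda>n. sum W {..<n}) at_top sequentially"
  shows "(\<lambda>n. sum D {..<n} / sum W {..<n}) \<longlonglongrightarrow> p"
proof (rule LIMSEQ_I)
  fix r :: real
  assume r: "0 < r"
  define E where "E n = D n - p * W n" for n
  have "\<forall>\<^sub>F n in sequentially. \<bar>D n / W n - p\<bar> < r / 2"
    using tendstoD[OF lim, of "r / 2"] r by (simp add: dist_real_def)
  then have "\<forall>\<^sub>F n in sequentially. \<bar>E n\<bar> \<le> r / 2 * W n"
    using pos
  proof eventually_elim
    case (elim n)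
    have "\<bar>E n\<bar> = \<bar>D n / W n - p\<bar> * W n"
      using elim(2) by (simp add: E_def abs_mult_pos field_simps flip: abs_mult)
    then show ?case
      using elim by simp
  qed
  then obtain N where N: "\<And>n. N \<le> n \<Longrightarrow> \<bar>E n\<bar> \<le> r / 2 * W n"
    by (auto simp: eventually_sequentially)
  \<comment> \<open>\<open>C\<close> makes the following bound an equality at \<open>n = N\<close>;
    each later term then adds at most \<open>r / 2 * W n\<close> to both sides.\<close>
  define C where "C = \<bar>sum E {..<N}\<bar> - r / 2 * sum W {..<N}"
  have bound: "\<bar>sum E {..<n}\<bar> \<le> C + r / 2 * sum W {..<n}" if "N \<le> n" for n
    using that
  proof (induction n rule: dec_induct)
    case (step n)
    then show ?case
      using N[of n] by (simp add: algebra_simps)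
  qed (simp add: C_def)
  have "\<forall>\<^sub>F n in sequentially. norm (sum D {..<n} / sum W {..<n} - p) < r"
    \<comment> \<open>A total weight above \<open>2 * C / r\<close> leaves the constant
      \<open>C\<close> below the other half of \<open>r * sum W {..<n}\<close>; the maximum with 0
      also makes the divisor positive.\<close>
    using at_top[unfolded filterlim_at_top_dense, rule_format, of "max 0 (2 * C / r)"]
      eventually_ge_at_top[of N]
  proof eventually_elim
    case (elim n)
    let ?S = "sum W {..<n}"
    have S: "0 < ?S" "C < r / 2 * ?S"
      using elim(1) r by (auto simp: field_simps)
    have "sum D {..<n} / ?S - p = sum E {..<n} / ?S"
      using S(1) by (simp add: E_def sum_subtractf sum_distrib_left field_simps)
    moreover have "\<bar>sum E {..<n}\<bar> < r * ?S"
      using bound[OF elim(2)] S by (simp add: field_simps)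
    ultimately show ?case
      using S(1) by (simp add: abs_div_pos[symmetric] pos_divide_less_eq)
  qed
  then show "\<exists>no. \<forall>n\<ge>no. norm (sum D {..<n} / sum W {..<n} - p) < r"
    by (simp add: eventually_sequentially)
qed

text \<open>\<open>h n\<close> is the number of the block that contains position \<open>n\<close>.
  It is the least index whose right end exceeds \<open>n\<close>, so empty blocks are skipped. It
  serves on two levels: for positions in the infinite word and for factors within the
  powers.\<close>

lemma block_index:
  fixes a :: "nat \<Rightarrow> nat"
  assumes mono: "incseq a"
    and a0: "a 0 = 0"
    and at_top: "filterlim a at_top sequentially"
  obtains h where "\<And>n. a (h n) \<le> n" "\<And>n. n < a (Suc (h n))" "filterlim h at_top sequentially"
proof -
  define h where "h n = (LEAST f. n < a (Suc f))" for n
  have ex: "\<exists>f. n < a (Suc f)" for n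
  proof -
    have "\<forall>\<^sub>F f in sequentially. Suc n \<le> a f"
      using at_top by (simp add: filterlim_at_top)
    then have "\<forall>\<^sub>F f in sequentially. Suc n \<le> a (Suc f)"
      by (rule eventually_compose_filterlim[OF _ filterlim_Suc])
    then show ?thesis
      by (auto simp: Suc_le_eq dest: eventually_happens)
  qed
  have h_upper: "n < a (Suc (h n))" for n
    unfolding h_def using ex by (rule LeastI_ex)
  have h_lower: "a (h n) \<le> n" for n
  proof (cases "h n")
    case (Suc f)
    then have "\<not> n < a (Suc f)"
      using not_less_Least[of f "\<lambda>f. n < a (Suc f)"] by (simp add: h_def)
    then show ?thesis
      using Suc by simp
  qed (simp add: a0)
  have h_at_top: "filterlim h at_top sequentially"
    unfolding filterlim_at_top
  proof
    fix K
    show "\<forall>\<^sub>F n in sequentially. K \<le> h n"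
      using eventually_ge_at_top[of "a K"]
    proof eventually_elim
      case (elim n)
      show ?case
      proof (rule ccontr)
        assume "\<not> K \<le> h n"
        then have "a (Suc (h n)) \<le> a K"
          using incseqD[OF mono, of "Suc (h n)" K] by simp
        then show False
          using h_upper[of n] elim by simp
      qed
    qed
  qed
  show thesis
    using h_lower h_upper h_at_top by (rule that)
qed

text \<open>At the boundaries the density is a weighted mean of the block densities. If
  \<open>n\<close> lies in block \<open>f\<close>, monotonicity of the counting function
  \<open>c\<close> puts \<open>c n / n\<close> between \<open>c (a f) / a (Suc f)\<close> and
  \<open>c (a (Suc f)) / a f\<close>. Both bounds tend to \<open>p\<close>, since
  \<open>small\<close> makes \<open>a (Suc f) / a f\<close> tend to 1.\<close>

lemma density_from_blocks:
  fixes S :: "nat set" and a :: "nat \<Rightarrow> nat" and p :: real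
  assumes mono: "incseq a"
    and a0: "a 0 = 0"
    and at_top: "filterlim a at_top sequentially"
    and pos: "\<forall>\<^sub>F g in sequentially. a g < a (Suc g)"
    and density: "(\<lambda>g. real (card (S \<inter> {a g..<a (Suc g)})) / real (a (Suc g) - a g)) \<longlonglongrightarrow> p"
    and small: "(\<lambda>g. real (a (Suc g) - a g) / real (a g)) \<longlonglongrightarrow> 0"
  shows "(\<lambda>n. real (card (S \<inter> {..<n})) / real n) \<longlonglongrightarrow> p"
proof -
  define c where "c n = real (card (S \<inter> {..<n}))" for n
  have c_mono: "c m \<le> c n" if "m \<le> n" for m n
    unfolding c_def using that by (intro of_nat_mono card_mono) auto
  have le: "a f \<le> a (Suc f)" for f
    using mono by (simp add: incseq_SucD)
  have sum_a: "(\<Sum>g<f. real (a (Suc g) - a g)) = real (a f)" for f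
    by (induction f) (simp_all add: a0 le)
  have sum_c: "(\<Sum>g<f. real (card (S \<inter> {a g..<a (Suc g)}))) = c (a f)" for f
  proof (induction f)
    case (Suc f)
    have "S \<inter> {..<a (Suc f)} = (S \<inter> {..<a f}) \<union> (S \<inter> {a f..<a (Suc f)})"
      using le[of f] by auto
    moreover have "card \<dots> = card (S \<inter> {..<a f}) + card (S \<inter> {a f..<a (Suc f)})"
      by (intro card_Un_disjoint) auto
    ultimately show ?case
      using Suc by (simp add: c_def)
  qed (simp add: c_def a0)
  have real_at_top: "filterlim (\<lambda>f. real (a f)) at_top sequentially"
    using at_top by (rule filterlim_compose[OF filterlim_real_sequentially])
  \<comment> \<open>The weights are the block lengths; numerator and denominator telescope to
    \<open>c (a f)\<close> and \<open>a f\<close>.\<close>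
  have ends: "(\<lambda>f. c (a f) / real (a f)) \<longlonglongrightarrow> p"
    using weighted_cesaro[OF density] pos real_at_top by (simp add: sum_a sum_c)
  have a_pos: "\<forall>\<^sub>F f in sequentially. 0 < a f"
    using at_top[unfolded filterlim_at_top, rule_format, of 1] by eventually_elim simp
  have ratio_limit: "(\<lambda>f. 1 + real (a (Suc f) - a f) / real (a f)) \<longlonglongrightarrow> 1 + 0"
    by (intro tendsto_intros small)
  have ratio_eq: "\<forall>\<^sub>F f in sequentially.
      1 + real (a (Suc f) - a f) / real (a f) = real (a (Suc f)) / real (a f)"
    using a_pos by eventually_elim (simp add: le field_simps)
  have ratio: "(\<lambda>f. real (a (Suc f)) / real (a f)) \<longlonglongrightarrow> 1"
    using Lim_transform_eventually[OF ratio_limit ratio_eq] by simp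
  have upper_limit: "(\<lambda>f. c (a (Suc f)) / real (a (Suc f)) * (real (a (Suc f)) / real (a f))) \<longlonglongrightarrow> p * 1"
    by (intro tendsto_mult ratio LIMSEQ_Suc[OF ends])
  have upper_eq: "\<forall>\<^sub>F f in sequentially. c (a (Suc f)) / real (a (Suc f)) *
      (real (a (Suc f)) / real (a f)) = c (a (Suc f)) / real (a f)"
    using a_pos
  proof eventually_elim
    case (elim f)
    then show ?case
      using le[of f] by simp
  qed
  have upper: "(\<lambda>f. c (a (Suc f)) / real (a f)) \<longlonglongrightarrow> p"
    using Lim_transform_eventually[OF upper_limit upper_eq] by simp
  have lower_limit: "(\<lambda>f. c (a f) / real (a f) / (real (a (Suc f)) / real (a f))) \<longlonglongrightarrow> p / 1"
    by (intro tendsto_divide ratio ends) simp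
  have lower_eq: "\<forall>\<^sub>F f in sequentially. c (a f) / real (a f) /
      (real (a (Suc f)) / real (a f)) = c (a f) / real (a (Suc f))"
    using a_pos by eventually_elim auto
  have lower: "(\<lambda>f. c (a f) / real (a (Suc f))) \<longlonglongrightarrow> p"
    using Lim_transform_eventually[OF lower_limit lower_eq] by simp
  obtain h where h_lower: "\<And>n. a (h n) \<le> n" and h_upper: "\<And>n. n < a (Suc (h n))"
    and h_at_top: "filterlim h at_top sequentially"
    using mono a0 at_top by (rule block_index) blast
  show ?thesis
    unfolding c_def[symmetric]
  proof (rule tendsto_sandwich)
    show "(\<lambda>n. c (a (h n)) / real (a (Suc (h n)))) \<longlonglongrightarrow> p"
      using lower h_at_top by (rule filterlim_compose)
    show "(\<lambda>n. c (a (Suc (h n))) / real (a (h n))) \<longlonglongrightarrow> p"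
      using upper h_at_top by (rule filterlim_compose)
    show "\<forall>\<^sub>F n in sequentially. c (a (h n)) / real (a (Suc (h n))) \<le> c n / real n"
      using eventually_gt_at_top[of 0]
    proof eventually_elim
      case (elim n)
      show ?case
        using c_mono[OF h_lower[of n]] h_upper[of n] elim
        by (intro frac_le) (auto simp: c_def)
    qed
    show "\<forall>\<^sub>F n in sequentially. c n / real n \<le> c (a (Suc (h n))) / real (a (h n))"
      using eventually_compose_filterlim[OF a_pos h_at_top]
    proof eventually_elim
      case (elim n)
      show ?case
        using c_mono[of n "a (Suc (h n))"] h_upper[of n] h_lower[of n] elim
        by (intro frac_le) (auto simp: c_def)
    qed
  qed
qed

section \<open>Occurrences of a word inside blocks of an infinite word\<close>

text \<open>\<open>count_fin\<close> sees only occurrences that end inside the window, whereas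
  \<open>S\<close> also records those that start in it and run past its right end. The latter start
  among the last \<open>length b\<close> positions.\<close>

lemma card_matches_subsequence:
  fixes x :: "'a word" and b :: "'a list"
  assumes b: "b \<noteq> []"
  defines "S \<equiv> {i. subsequence x i (i + length b) = b}"
  shows "count_fin b (subsequence x s t) \<le> card (S \<inter> {s..<t})"
    and "card (S \<inter> {s..<t}) \<le> count_fin b (subsequence x s t) + length b"
proof -
  define M where "M = {i. i < t - s \<and> take (length b) (drop i (subsequence x s t)) = b}"
  \<comment> \<open>A truncated \<open>take\<close> near the end of the window is shorter than
    \<open>b\<close> and cannot match. Conversely, \<open>b\<close> being nonempty, an occurrence
    that ends by \<open>t\<close> starts strictly before \<open>t\<close>.\<close>
  have M: "i \<in> M \<longleftrightarrow> s + i + length b \<le> t \<and> s + i \<in> S" for i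
  proof -
    have "take (length b) (drop i (subsequence x s t)) =
        subsequence x (s + i) (min (s + i + length b) t)"
      by simp
    moreover have "s + i + length b \<le> t" if "subsequence x (s + i) (min (s + i + length b) t) = b"
      using arg_cong[OF that, of length] b by (cases "length b") (auto split: if_splits)
    ultimately show ?thesis
      using b by (cases b) (auto simp: M_def S_def min_def)
  qed
  have count: "count_fin b (subsequence x s t) = card M"
    by (simp add: count_fin_def M_def)
  have card_image: "card ((+) s ` M) = card M"
    by (simp add: card_image)
  have "(+) s ` M \<subseteq> S \<inter> {s..<t}"
    using b by (cases b) (auto simp: M)
  then have "card ((+) s ` M) \<le> card (S \<inter> {s..<t})"
    by (intro card_mono) auto
  then show "count_fin b (subsequence x s t) \<le> card (S \<inter> {s..<t})"
    by (simp add: count card_image)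
  have "i \<in> (+) s ` M" if "i \<in> S" "s \<le> i" "i + length b \<le> t" for i
    using that by (intro image_eqI[of _ _ "i - s"]) (auto simp: M)
  then have "S \<inter> {s..<t} \<subseteq> (+) s ` M \<union> {t - length b..<t}"
    by (fastforce simp: not_le)
  then have "card (S \<inter> {s..<t}) \<le> card ((+) s ` M \<union> {t - length b..<t})"
    by (rule card_mono[rotated]) (simp add: M_def)
  also have "\<dots> \<le> card ((+) s ` M) + card {t - length b..<t}"
    by (rule card_Un_le)
  also have "\<dots> \<le> card M + length b"
    by (simp add: card_image)
  finally show "card (S \<inter> {s..<t}) \<le> count_fin b (subsequence x s t) + length b"
    by (simp add: count)
qed

text \<open>Connecting words and occurrences across a boundary change length and count of a block by
  bounded amounts, negligible against \<open>length (v f)\<close>. In \<open>small\<close> the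
  denominator omits the connecting words; this only makes it smaller than the true boundary
  position.\<close>

lemma frequency_of_concatenation:
  fixes x :: "'a word" and c v :: "nat \<Rightarrow> 'a list" and b :: "'a list" and p :: real
  defines "E \<equiv> \<lambda>f. concat (map (\<lambda>g. c g @ v g) [0..<f])"
  assumes x: "\<And>f. prefix (length (E f)) x = E f"
    and c: "\<And>f. length (c f) \<le> j"
    and b: "b \<noteq> []"
    and v: "filterlim (\<lambda>f. length (v f)) at_top sequentially"
    and frequency: "(\<lambda>f. real (count_fin b (v f)) / real (length (v f))) \<longlonglongrightarrow> p"
    and small: "(\<lambda>f. real (length (v f)) / real (\<Sum>g<f. length (v g))) \<longlonglongrightarrow> 0"
  shows "(\<lambda>n. real (count_inf n b x) / real n) \<longlonglongrightarrow> p"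
proof -
  define a where "a f = length (E f)" for f
  define S where "S = {i. subsequence x i (i + length b) = b}"
  define d where "d f = card (S \<inter> {a f..<a (Suc f)})" for f
  define V where "V f = (\<Sum>g<f. length (v g))" for f
  have E_Suc: "E (Suc f) = E f @ c f @ v f" for f
    by (simp add: E_def)
  have a_Suc: "a (Suc f) = a f + length (c f) + length (v f)" for f
    by (simp add: a_def E_Suc)
  have V_le: "V f \<le> a f" for f
    by (induction f) (auto simp: V_def a_Suc)
  have v_eq: "subsequence x (a f + length (c f)) (a (Suc f)) = v f" for f
  proof -
    have "subsequence x (a f + length (c f)) (a (Suc f)) = drop (a f + length (c f)) (prefix (a (Suc f)) x)"
      by simp
    also have "\<dots> = v f"
      using x[of "Suc f"] by (simp only: a_def) (simp add: E_Suc)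
    finally show ?thesis .
  qed
  \<comment> \<open>At most \<open>j\<close> occurrences start in the connecting word
    \<open>c f\<close>, and at most \<open>length b\<close> start in \<open>v f\<close> and leave
    it.\<close>
  have d_ge: "count_fin b (v f) \<le> d f" and d_le: "d f \<le> count_fin b (v f) + (j + length b)" for f
  proof -
    let ?s = "a f + length (c f)"
    let ?T = "S \<inter> {?s..<a (Suc f)}"
    have T: "count_fin b (v f) \<le> card ?T" "card ?T \<le> count_fin b (v f) + length b"
      using card_matches_subsequence[OF b, of x ?s "a (Suc f)"] by (simp_all add: v_eq S_def)
    have "card ?T \<le> d f"
      unfolding d_def by (intro card_mono) auto
    then show "count_fin b (v f) \<le> d f"
      using T(1) by simp
    have "d f \<le> card ({a f..<?s} \<union> ?T)"
      unfolding d_def by (intro card_mono) auto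
    also have "\<dots> \<le> card {a f..<?s} + card ?T"
      by (rule card_Un_le)
    finally show "d f \<le> count_fin b (v f) + (j + length b)"
      using T(2) c[of f] by simp
  qed
  have v_real: "filterlim (\<lambda>f. real (length (v f))) at_top sequentially"
    using v by (rule filterlim_compose[OF filterlim_real_sequentially])
  have v_pos: "\<forall>\<^sub>F f in sequentially. 0 < length (v f)"
    using v[unfolded filterlim_at_top, rule_format, of 1] by eventually_elim (simp add: Suc_le_eq)
  have V_at_top: "filterlim V at_top sequentially"
  proof -
    have "filterlim (\<lambda>f. V (Suc f)) at_top sequentially"
      using v by (rule filterlim_at_top_mono) (simp add: V_def)
    then show ?thesis
      by (simp add: filterlim_sequentially_Suc)
  qed
  have V_real: "filterlim (\<lambda>f. real (V f)) at_top sequentially"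
    using V_at_top by (rule filterlim_compose[OF filterlim_real_sequentially])
  have V_pos: "\<forall>\<^sub>F f in sequentially. 0 < V f"
    using V_at_top[unfolded filterlim_at_top, rule_format, of 1] by eventually_elim simp
  have null: "(\<lambda>f. r f / real (length (v f))) \<longlonglongrightarrow> 0"
    if "\<And>f. 0 \<le> r f" "\<And>f. r f \<le> R" for r :: "nat \<Rightarrow> real" and R
  proof (rule tendsto_sandwich[OF _ _ tendsto_const])
    show "(\<lambda>f. R / real (length (v f))) \<longlonglongrightarrow> 0"
      using v_real by (intro real_tendsto_divide_at_top[OF tendsto_const])
  qed (use that in \<open>auto intro!: always_eventually divide_right_mono\<close>)
  \<comment> \<open>This is the block density with numerator and denominator both divided by
    \<open>length (v f)\<close>.\<close>
  have density_limit: "(\<lambda>f. (real (count_fin b (v f)) / real (length (v f)) +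
        (real (d f) - real (count_fin b (v f))) / real (length (v f))) /
      (1 + real (length (c f)) / real (length (v f)))) \<longlonglongrightarrow> (p + 0) / (1 + 0)"
  proof (intro tendsto_intros frequency)
    show "(\<lambda>f. (real (d f) - real (count_fin b (v f))) / real (length (v f))) \<longlonglongrightarrow> 0"
    proof (rule null)
      show "real (d f) - real (count_fin b (v f)) \<le> real (j + length b)" for f
        using d_le[of f] by linarith
    qed (simp add: d_ge)
    show "(\<lambda>f. real (length (c f)) / real (length (v f))) \<longlonglongrightarrow> 0"
      by (rule null[of _ "real j"]) (auto simp: c)
  qed simp
  have density_eq: "\<forall>\<^sub>F f in sequentially.
      (real (count_fin b (v f)) / real (length (v f)) +
        (real (d f) - real (count_fin b (v f))) / real (length (v f))) /
      (1 + real (length (c f)) / real (length (v f))) = real (d f) / real (a (Suc f) - a f)"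
    using v_pos by eventually_elim (simp add: a_Suc field_simps)
  have density: "(\<lambda>f. real (d f) / real (a (Suc f) - a f)) \<longlonglongrightarrow> p"
    using Lim_transform_eventually[OF density_limit density_eq] by simp
  have "(\<lambda>n. real (card (S \<inter> {..<n})) / real n) \<longlonglongrightarrow> p"
  proof (rule density_from_blocks[where a = a])
    show "incseq a"
      by (rule incseq_SucI) (simp add: a_Suc)
    show "a 0 = 0"
      by (simp add: a_def E_def)
    show "filterlim a at_top sequentially"
      using V_at_top by (rule filterlim_at_top_mono) (simp add: V_le)
    show "\<forall>\<^sub>F f in sequentially. a f < a (Suc f)"
      using v_pos by eventually_elim (simp add: a_Suc)
    show "(\<lambda>f. real (card (S \<inter> {a f..<a (Suc f)})) / real (a (Suc f) - a f)) \<longlonglongrightarrow> p"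
      using density by (simp add: d_def)
    show "(\<lambda>f. real (a (Suc f) - a f) / real (a f)) \<longlonglongrightarrow> 0"
    proof (rule tendsto_sandwich[OF _ _ tendsto_const])
      have "(\<lambda>f. real j / real (V f) + real (length (v f)) / real (V f)) \<longlonglongrightarrow> 0 + 0"
        using small V_real
        by (intro tendsto_add real_tendsto_divide_at_top[OF tendsto_const]) (simp_all add: V_def)
      then show "(\<lambda>f. real j / real (V f) + real (length (v f)) / real (V f)) \<longlonglongrightarrow> 0"
        by simp
      show "\<forall>\<^sub>F f in sequentially. real (a (Suc f) - a f) / real (a f)
          \<le> real j / real (V f) + real (length (v f)) / real (V f)"
        using V_pos
      proof eventually_elim
        case (elim f)
        have "real (a (Suc f) - a f) / real (a f) \<le> real (j + length (v f)) / real (V f)"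
          using elim V_le[of f] c[of f] by (intro frac_le) (auto simp: a_Suc)
        then show ?case
          by (simp add: add_divide_distrib)
      qed
    qed simp
  qed
  moreover have "count_inf n b x = card (S \<inter> {..<n})" for n
    unfolding count_inf_def S_def by (rule arg_cong[where f = card]) auto
  ultimately show ?thesis
    by simp
qed

section \<open>From powers of words to a sequence of factors\<close>

lemma odot_snoc: "xs \<noteq> [] \<Longrightarrow> odot u (xs @ [b]) = odot u xs @ u (last xs) b @ b"
  by (induction u xs rule: odot.induct) auto

text \<open>Attaching each connecting word to the factor on its right turns the iterated product
  into an ordinary concatenation, whose first block has no connecting word. The induction appends
  factors on the right, hence \<open>odot_snoc\<close>.\<close>

lemma odot_prefix:
  "odot u (prefix f v) =
     concat (map (\<lambda>g. (if g = 0 then [] else u (v (g - 1)) (v g)) @ v g) [0..<f])"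
proof (induction f)
  case (Suc f)
  show ?case
  proof (cases f)
    case (Suc g)
    then have last: "prefix f v \<noteq> []" "last (prefix f v) = v g"
      by simp_all
    have "odot u (prefix (Suc f) v) = odot u (prefix f v @ [v f])"
      by simp
    also have "\<dots> = odot u (prefix f v) @ u (v g) (v f) @ v f"
      using odot_snoc[OF last(1), of u "v f"] by (simp only: last(2))
    finally show ?thesis
      unfolding Suc.IH using Suc by (simp del: subseq_to_Suc)
  qed simp
qed simp

text \<open>This list is the argument of \<open>odot\<close> in \<open>odot_blocks\<close>. Kept
  separate, it lets individual factors be numbered across the powers.\<close>

definition factors :: "(nat \<Rightarrow> nat) \<Rightarrow> (nat \<Rightarrow> 'a list) \<Rightarrow> nat \<Rightarrow> 'a list list" where
  "factors l w n = concat (map (\<lambda>i. replicate (l i) (w i)) [1..<Suc n])"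

lemma factors_0 [simp]: "factors l w 0 = []"
  by (simp add: factors_def)

lemma factors_Suc [simp]:
  "factors l w (Suc n) = factors l w n @ replicate (l (Suc n)) (w (Suc n))"
  by (simp add: factors_def)

lemma length_factors_at_top:
  assumes "\<forall>\<^sub>F i in sequentially. l i \<noteq> 0"
  shows "filterlim (\<lambda>n. length (factors l w n)) at_top sequentially"
proof -
  obtain N where N: "\<And>i. N \<le> i \<Longrightarrow> l i \<noteq> 0"
    using assms by (auto simp: eventually_sequentially)
  have le: "m \<le> length (factors l w (N + m))" for m
  proof (induction m)
    case (Suc m)
    then show ?case
      using N[of "Suc (N + m)"] by simp
  qed simp
  show ?thesis
    unfolding filterlim_at_top
  proof
    fix m
    show "\<forall>\<^sub>F n in sequentially. m \<le> length (factors l w n)"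
      using eventually_ge_at_top[of "N + m"]
    proof eventually_elim
      case (elim n)
      then show ?case
        using le[of "n - N"] by simp
    qed
  qed
qed

text \<open>Hypotheses on the words \<open>w i\<close> carry over to the single factors by
  composition with \<open>h\<close>: factor \<open>f\<close> is \<open>w (Suc (h f))\<close>, and
  the powers with indices up to \<open>h f\<close> are complete before it. So
  \<open>frequency_of_concatenation\<close> applies to the sequence of factors.\<close>

lemma frequency_omega_word:
  assumes u: "connecting_words L j u"
    and w: "\<And>i. 1 \<le> i \<Longrightarrow> w i \<in> L"
    and l: "\<forall>\<^sub>F i in sequentially. l i \<noteq> 0"
    and length_w: "filterlim (\<lambda>i. length (w i)) at_top sequentially"
    and small: "(\<lambda>i. 1 / real (l i) * (real (length (w (Suc i))) / real (length (w i)))) \<longlonglongrightarrow> 0"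
    and b: "b \<noteq> []"
    and frequency: "(\<lambda>i. real (count_fin b (w i)) / real (length (w i))) \<longlonglongrightarrow> p"
  shows "(\<lambda>n. real (count_inf n b (omega_word u l w)) / real n) \<longlonglongrightarrow> p"
proof -
  define F where "F = factors l w"
  \<comment> \<open>Here \<open>limit_word\<close> acts one level up: \<open>v\<close> is an
    infinite word whose letters are finite words.\<close>
  define v where "v = limit_word F"
  define c where "c g = (if g = 0 then [] else u (v (g - 1)) (v g))" for g
  define E where "E f = concat (map (\<lambda>g. c g @ v g) [0..<f])" for f
  have F_at_top: "filterlim (\<lambda>n. length (F n)) at_top sequentially"
    unfolding F_def using l by (rule length_factors_at_top)
  have v_prefix: "prefix (length (F n)) v = F n" for n
    unfolding v_def
  proof (rule prefix_limit_word)
    show "\<exists>m. n < length (F m)" for n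
      using F_at_top[unfolded filterlim_at_top, rule_format, of "Suc n"]
      by (auto simp: Suc_le_eq dest: eventually_happens)
  qed (simp add: F_def)
  \<comment> \<open>The blocks are now the powers, measured in numbers of factors; a power with
    exponent 0 is an empty block.\<close>
  obtain h where h_lower: "\<And>n. length (F (h n)) \<le> n"
    and h_upper: "\<And>n. n < length (F (Suc (h n)))"
    and h_at_top: "filterlim h at_top sequentially"
  proof (rule block_index[of "\<lambda>n. length (F n)"])
    show "incseq (\<lambda>n. length (F n))"
      by (rule incseq_SucI) (simp add: F_def)
  qed (use F_at_top in \<open>auto simp: F_def\<close>)
  have v_eq: "v f = w (Suc (h f))" for f
  proof -
    have "v f = prefix (length (F (Suc (h f)))) v ! f"
      using h_upper[of f] by simp
    also have "\<dots> = F (Suc (h f)) ! f"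
      by (simp only: v_prefix)
    also have "\<dots> = w (Suc (h f))"
      using h_lower[of f] h_upper[of f] by (simp add: F_def nth_append)
    finally show ?thesis .
  qed
  have Suc_h: "filterlim (\<lambda>f. Suc (h f)) at_top sequentially"
    using filterlim_Suc h_at_top by (rule filterlim_compose)
  have v_in: "v f \<in> L" for f
    by (simp add: v_eq w)
  have c_le: "length (c f) \<le> j" for f
    using u v_in by (simp add: c_def connecting_words_def)
  have length_v: "filterlim (\<lambda>f. length (v f)) at_top sequentially"
    unfolding v_eq using length_w Suc_h by (rule filterlim_compose)
  have E_odot: "E f = odot u (prefix f v)" for f
    by (simp add: E_def c_def odot_prefix)
  have E_append: "\<exists>s. E (f + g) = E f @ s" for f g
    by (induction g) (auto simp: E_def)
  have "length (v f) \<le> length (E (Suc f))" for f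
    by (simp add: E_def)
  then have "filterlim (\<lambda>f. length (E (Suc f))) at_top sequentially"
    by (intro filterlim_at_top_mono[OF length_v]) simp
  then have E_at_top: "filterlim (\<lambda>f. length (E f)) at_top sequentially"
    by (rule filterlim_sequentially_Suc[THEN iffD1])
  have blocks: "odot_blocks u l w n = E (length (F n))" for n
    by (simp only: E_odot v_prefix) (simp add: odot_blocks_def F_def factors_def)
  have omega_E: "prefix (length (E (length (F n)))) (omega_word u l w) = E (length (F n))" for n
    unfolding omega_word_def blocks[symmetric]
  proof (rule prefix_limit_word)
    show "\<exists>s. odot_blocks u l w (Suc m) = odot_blocks u l w m @ s" for m
      using E_append[of "length (F m)" "l (Suc m)"] by (simp add: blocks F_def)
    show "\<exists>m. n < length (odot_blocks u l w m)" for n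
      using filterlim_compose[OF E_at_top F_at_top, unfolded filterlim_at_top, rule_format, of "Suc n"]
      by (auto simp: blocks Suc_le_eq dest: eventually_happens)
  qed
  \<comment> \<open>The limit is known to extend \<open>E\<close> only at the ends of full powers.
    Any \<open>E f\<close> is a prefix of the word at the next such end.\<close>
  have omega: "prefix (length (E f)) (omega_word u l w) = E f" for f
  proof -
    let ?n = "Suc (h f)"
    obtain s where s: "E (length (F ?n)) = E f @ s"
      using E_append[of f "length (F ?n) - f"] h_upper[of f] by auto
    have "prefix (length (E f)) (omega_word u l w) =
        take (length (E f)) (prefix (length (E (length (F ?n)))) (omega_word u l w))"
      by (simp add: s min_def)
    also have "\<dots> = E f"
      unfolding omega_E by (simp add: s)
    finally show ?thesis .
  qed
  have sum_F: "(\<Sum>g<length (F n). length (v g)) = sum_list (map length (F n))" for n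
  proof -
    have "sum_list (map length (F n)) = sum_list (map length (prefix (length (F n)) v))"
      by (simp only: v_prefix)
    also have "\<dots> = (\<Sum>g<length (F n). length (v g))"
      by (simp add: subsequence_def interv_sum_list_conv_sum_set_nat atLeast0LessThan)
    finally show ?thesis
      by simp
  qed
  \<comment> \<open>The power with index \<open>n = h f\<close> is complete before factor
    \<open>f\<close>, so its \<open>l n\<close> copies of \<open>w n\<close> alone give the bound.
    Powers are indexed from 1, hence \<open>0 < n\<close>.\<close>
  have sum_ge: "l n * length (w n) \<le> (\<Sum>g<f. length (v g))" if "h f = n" "0 < n" for f n
  proof -
    have "l n * length (w n) \<le> sum_list (map length (F n))"
      using that(2) by (cases n) (simp_all add: F_def sum_list_replicate)
    also have "\<dots> \<le> (\<Sum>g<f. length (v g))"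
      unfolding sum_F[symmetric] using h_lower[of f] that(1) by (intro sum_mono2) auto
    finally show ?thesis .
  qed
  have "\<forall>\<^sub>F i in sequentially. 1 \<le> length (w i)"
    using length_w by (simp only: filterlim_at_top)
  then have "\<forall>\<^sub>F i in sequentially. 0 < i \<and> 0 < l i * length (w i)"
    using l eventually_gt_at_top[of 0] by eventually_elim (simp add: Suc_le_eq)
  \<comment> \<open>Since \<open>h\<close> tends to infinity, the index \<open>h f\<close>
    eventually avoids 0 and all vanishing exponents and lengths, so the divisor in the estimate is
    positive.\<close>
  from eventually_compose_filterlim[OF this h_at_top]
  have upper: "\<forall>\<^sub>F f in sequentially. real (length (v f)) / real (\<Sum>g<f. length (v g))
      \<le> 1 / real (l (h f)) * (real (length (w (Suc (h f)))) / real (length (w (h f))))"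
  proof eventually_elim
    case (elim f)
    have "real (length (v f)) / real (\<Sum>g<f. length (v g))
        \<le> real (length (v f)) / real (l (h f) * length (w (h f)))"
      using elim sum_ge[of f] by (intro frac_le of_nat_mono) auto
    then show ?case
      by (simp add: v_eq)
  qed
  have small_v: "(\<lambda>f. real (length (v f)) / real (\<Sum>g<f. length (v g))) \<longlonglongrightarrow> 0"
    by (rule tendsto_sandwich[OF _ upper tendsto_const filterlim_compose[OF small h_at_top]])
      (simp add: sum_nonneg)
  have frequency_v: "(\<lambda>f. real (count_fin b (v f)) / real (length (v f))) \<longlonglongrightarrow> p"
    unfolding v_eq using frequency Suc_h by (rule filterlim_compose)
  show ?thesis
    using omega c_le b length_v frequency_v small_v unfolding E_def
    by (rule frequency_of_concatenation)
qed

section \<open>Consequences of goodness and of the parameter conditions\<close>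

text \<open>The gaps between successive \<open>\<epsilon> i\<close> are positive and tend to 0, so
  their reciprocals diverge; the first growth condition makes the lengths eventually dominate these
  reciprocals.\<close>

lemma good_length_at_top:
  assumes "class_F L l \<epsilon> k \<nu>" "good l \<epsilon> k \<nu> \<mu> w"
  shows "filterlim (\<lambda>i. length (w i)) at_top sequentially"
proof -
  have eps: "\<epsilon> \<longlonglongrightarrow> 0" and dec: "\<And>i. 1 \<le> i \<Longrightarrow> \<epsilon> (Suc i) < \<epsilon> i"
    using assms(1) by (auto simp: class_F_def)
  have "(\<lambda>i. \<epsilon> i - \<epsilon> (Suc i)) \<longlonglongrightarrow> 0 - 0"
    by (intro tendsto_diff eps LIMSEQ_Suc[OF eps])
  then have "(\<lambda>i. \<epsilon> (i - 1) - \<epsilon> i) \<longlonglongrightarrow> 0"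
    by (subst filterlim_sequentially_Suc[symmetric]) simp
  moreover have "\<forall>\<^sub>F i in sequentially. 0 < \<epsilon> (i - 1) - \<epsilon> i"
    \<comment> \<open>From \<open>i = 2\<close> on, the gap does not involve
      \<open>\<epsilon> 0\<close>, which is arbitrary.\<close>
    using eventually_ge_at_top[of 2]
  proof eventually_elim
    case (elim i)
    then show ?case
      using dec[of "i - 1"] by simp
  qed
  ultimately have "filterlim (\<lambda>i. inverse (\<epsilon> (i - 1) - \<epsilon> i)) at_top sequentially"
    by (rule filterlim_inverse_at_top)
  moreover have "\<forall>\<^sub>F i in sequentially. inverse (\<epsilon> (i - 1) - \<epsilon> i) \<le> real (length (w i))"
  proof -
    have "(\<lambda>i. 1 / (\<epsilon> (i - 1) - \<epsilon> i)) \<in> o(\<lambda>i. real (length (w i)))"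
      using assms(2) by (simp add: good_def)
    from landau_o.smallD[OF this zero_less_one] show ?thesis
      by eventually_elim (rule order_trans[OF abs_ge_self], simp add: inverse_eq_divide)
  qed
  ultimately have "filterlim (\<lambda>i. real (length (w i))) at_top sequentially"
    by (rule filterlim_at_top_mono)
  then show ?thesis
    by (simp add: filterlim_sequentially_iff_filterlim_real)
qed

text \<open>Normality with respect to \<open>\<nu> i\<close> traps the frequency between
  \<open>word_prob (\<nu> i) b * (1 - \<epsilon> i)\<close> and
  \<open>word_prob (\<nu> i) b * (1 + \<epsilon> i)\<close>, and both tend to
  \<open>word_prob \<mu> b\<close>.\<close>

lemma good_frequency:
  assumes "class_F L l \<epsilon> k \<nu>" "good l \<epsilon> k \<nu> \<mu> w"
    and b: "b \<in> admissible \<mu>"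
    and k: "\<forall>\<^sub>F i in sequentially. length b \<le> k i"
  shows "(\<lambda>i. real (count_fin b (w i)) / real (length (w i))) \<longlonglongrightarrow> word_prob \<mu> b"
proof -
  let ?P = "\<lambda>i. word_prob (\<nu> i) b"
  have eps: "\<epsilon> \<longlonglongrightarrow> 0"
    using assms(1) by (simp add: class_F_def)
  have normal: "\<forall>i\<ge>1. normal_fin (\<epsilon> i) (k i) (\<nu> i) (w i)" and conv: "?P \<longlonglongrightarrow> word_prob \<mu> b"
    using assms(2) by (auto simp: good_def measures_converge_def)
  \<comment> \<open>The limit is nonzero, so \<open>b\<close> is eventually admissible for
    \<open>\<nu> i\<close> and the normality of \<open>w i\<close> speaks about it.\<close>
  have nz: "\<forall>\<^sub>F i in sequentially. ?P i \<noteq> 0"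
    using conv by (rule tendsto_imp_eventually_ne) (use b in \<open>simp add: admissible_def\<close>)
  have "\<forall>\<^sub>F i in sequentially. 1 \<le> length (w i)"
    using good_length_at_top[OF assms(1,2)] by (simp only: filterlim_at_top)
  then have ev: "\<forall>\<^sub>F i in sequentially.
      ?P i * (1 - \<epsilon> i) \<le> real (count_fin b (w i)) / real (length (w i)) \<and>
      real (count_fin b (w i)) / real (length (w i)) \<le> ?P i * (1 + \<epsilon> i)"
    using nz k eventually_ge_at_top[of 1]
  proof eventually_elim
    case (elim i)
    then have "b \<in> admissible (\<nu> i)" "0 < real (length (w i))"
      by (auto simp: admissible_def)
    then show ?case
      using normal elim
      by (auto simp: normal_fin_def pos_le_divide_eq pos_divide_le_eq mult_ac)
  qed
  show ?thesis
  proof (rule tendsto_sandwich)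
    have "(\<lambda>i. ?P i * (1 - \<epsilon> i)) \<longlonglongrightarrow> word_prob \<mu> b * (1 - 0)"
      by (intro tendsto_intros conv eps)
    then show "(\<lambda>i. ?P i * (1 - \<epsilon> i)) \<longlonglongrightarrow> word_prob \<mu> b"
      by simp
    have "(\<lambda>i. ?P i * (1 + \<epsilon> i)) \<longlonglongrightarrow> word_prob \<mu> b * (1 + 0)"
      by (intro tendsto_intros conv eps)
    then show "(\<lambda>i. ?P i * (1 + \<epsilon> i)) \<longlonglongrightarrow> word_prob \<mu> b"
      by simp
  qed (use ev in \<open>auto elim: eventually_mono\<close>)
qed

text \<open>Were all \<open>k i\<close> below \<open>m\<close>, then by integrality they would be at
  most \<open>m - 1\<close>, a bound that passes to the limit.\<close>

lemma orders_eventually_le: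
  assumes mono: "mono_on {1..} k" and m: "m \<in> orders k"
  shows "\<forall>\<^sub>F i in sequentially. m \<le> k i"
proof -
  have "\<exists>i\<ge>1. m \<le> k i"
  proof (rule ccontr)
    assume "\<not> (\<exists>i\<ge>1. m \<le> k i)"
    then have less: "k i \<le> m - 1" if "1 \<le> i" for i
      using that by force
    \<comment> \<open>\<open>lim\<close> is meaningful only once convergence is known. Monotonicity
      starts at index 1, so the shifted sequence is shown to converge first.\<close>
    have "incseq (\<lambda>i. enat (k (Suc i)))"
      by (rule incseq_SucI) (use mono in \<open>auto simp: mono_on_def\<close>)
    then obtain x where "(\<lambda>i. enat (k (Suc i))) \<longlonglongrightarrow> x"
      using LIMSEQ_SUP by blast
    then have x: "(\<lambda>i. enat (k i)) \<longlonglongrightarrow> x"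
      by (subst (asm) filterlim_sequentially_Suc)
    have "x \<le> enat (m - 1)"
      using x by (rule LIMSEQ_le_const2) (use less in auto)
    moreover have "enat m \<le> x" "1 \<le> m"
      using m limI[OF x] by (auto simp: orders_def)
    ultimately have "enat m \<le> enat (m - 1)"
      by (meson order_trans)
    then show False
      using \<open>1 \<le> m\<close> by simp
  qed
  then obtain i where i: "1 \<le> i" "m \<le> k i"
    by blast
  show ?thesis
    using eventually_ge_at_top[of i]
  proof eventually_elim
    case (elim i')
    then have "k i \<le> k i'"
      using i(1) by (intro mono_onD[OF mono]) auto
    then show ?case
      using i(2) by simp
  qed
qed

theorem theorem1:
  fixes L :: "'a list set"
    and j :: nat
    and u :: "'a list \<Rightarrow> 'a list \<Rightarrow> 'a list"
    and \<mu> :: "'a word measure"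
    and l :: "nat \<Rightarrow> nat"
    and \<epsilon> :: "nat \<Rightarrow> real"
    and k :: "nat \<Rightarrow> nat"
    and \<nu> :: "nat \<Rightarrow> 'a word measure"
    and w :: "nat \<Rightarrow> 'a list"
  assumes "specification_property L j"
    and "connecting_words L j u"
    and "\<mu> \<in> invariant_measures L"
    and "class_F L l \<epsilon> k \<nu>"
    and "\<forall>i\<ge>1. w i \<in> L"
    and "good l \<epsilon> k \<nu> \<mu> w"
  shows "(\<forall>m\<in>orders k. omega_word u l w \<in> normal_order \<mu> m) \<and>
         (filterlim k at_top sequentially \<longrightarrow> omega_word u l w \<in> normal_words \<mu>)"
proof -
  have small: "(\<lambda>i. 1 / real (l i) * (real (length (w (Suc i))) / real (length (w i)))) \<longlonglongrightarrow> 0"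
    and l: "\<forall>\<^sub>F i in sequentially. l i \<noteq> 0"
    using assms(6) by (auto simp: good_def dest: smalloD_tendsto)
  \<comment> \<open>Both claims reduce to this: an order \<open>m\<close> is reached as soon as
    \<open>k i\<close> eventually stays at or above it. That holds for \<open>m\<close> in
    \<open>orders k\<close>, and for every \<open>m\<close> when \<open>k\<close> is unbounded in
    the limit. The bound \<open>1 \<le> m\<close> makes \<open>b\<close> nonempty.\<close>
  have normal: "omega_word u l w \<in> normal_order \<mu> m"
    if m: "1 \<le> m" "\<forall>\<^sub>F i in sequentially. m \<le> k i" for m
    unfolding normal_order_def
  proof (clarify)
    fix b
    assume b: "b \<in> admissible \<mu>" "m = length b"
    show "(\<lambda>n. real (count_inf n b (omega_word u l w)) / real n) \<longlonglongrightarrow> word_prob \<mu> b"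
    proof (rule frequency_omega_word[OF assms(2) _ l good_length_at_top[OF assms(4,6)] small])
      show "(\<lambda>i. real (count_fin b (w i)) / real (length (w i))) \<longlonglongrightarrow> word_prob \<mu> b"
        using assms(4,6) b(1) m(2)[unfolded b(2)] by (rule good_frequency)
    qed (use assms(5) m(1) b(2) in auto)
  qed
  have "mono_on {1..} k"
    using assms(4) by (simp add: class_F_def)
  then have "\<forall>m\<in>orders k. omega_word u l w \<in> normal_order \<mu> m"
    using normal orders_eventually_le by (auto simp: orders_def)
  moreover have "omega_word u l w \<in> normal_words \<mu>" if "filterlim k at_top sequentially"
    using normal that by (auto simp: normal_words_def filterlim_at_top)
  ultimately show ?thesis
    by blast
qed

end
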